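(* Let $q$ be a prime power and $k$ a non-negative integer. Let $M$ be a simple $GF(q)$-matroid with no coloops that has two $k$-loose elements $e$ and $f$. Then $r(M) \leq (q+1)(k-1)+2q$, or $\{e,f\}$ is a cocircuit of $M$.
   Context: A $GF(q)$-matroid is a matroid representable over the field with $q$ elements. For a matroid $M$ of rank $r$ and a non-negative integer $k$, an element $t$ of $M$ is called $k$-loose if every circuit of $M$ that contains $t$ has size greater than $r-k$. A matroid is simple if it has no loops and no parallel pairs. *)

theory Defs
  imports
    "HOL-Number_Theory.Prime_Powers"
    "Jordan_Normal_Form.Missing_VectorSpace"
begin

record 'a set_system =
  ground :: "'a set"
  indep :: "'a set \<Rightarrow> bool"

definition matroid :: "'a set_system \<Rightarrow> bool" where
  "matroid M \<longleftrightarrow>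
     finite (ground M) \<and>
     (\<forall>X. indep M X \<longrightarrow> X \<subseteq> ground M) \<and>
     indep M {} \<and>
     (\<forall>X Y. indep M X \<longrightarrow> Y \<subseteq> X \<longrightarrow> indep M Y) \<and>
     (\<forall>X Y. indep M X \<longrightarrow> indep M Y \<longrightarrow> card X < card Y \<longrightarrow>
        (\<exists>y \<in> Y - X. indep M (insert y X)))"

definition basis :: "'a set_system \<Rightarrow> 'a set \<Rightarrow> bool" where
  "basis M B \<longleftrightarrow> indep M B \<and> (\<forall>X. indep M X \<longrightarrow> B \<subseteq> X \<longrightarrow> X = B)"

definition circuit :: "'a set_system \<Rightarrow> 'a set \<Rightarrow> bool" where
  "circuit M C \<longleftrightarrow> C \<subseteq> ground M \<and> \<not> indep M C \<and> (\<forall>X. X \<subset> C \<longrightarrow> indep M X)"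

definition rank :: "'a set_system \<Rightarrow> nat" where
  "rank M = Max {card X | X. indep M X}"

text \<open>The bases of the dual are the complements of the bases of \<open>M\<close>.\<close>

definition dual :: "'a set_system \<Rightarrow> 'a set_system" where
  "dual M = \<lparr> ground = ground M, indep = (\<lambda>X. \<exists>B. basis M B \<and> X \<subseteq> ground M - B) \<rparr>"

definition loop :: "'a set_system \<Rightarrow> 'a \<Rightarrow> bool" where
  "loop M x \<longleftrightarrow> circuit M {x}"

definition parallel_pair :: "'a set_system \<Rightarrow> 'a \<Rightarrow> 'a \<Rightarrow> bool" where
  "parallel_pair M x y \<longleftrightarrow> x \<noteq> y \<and> circuit M {x, y}"

definition simple_matroid :: "'a set_system \<Rightarrow> bool" where
  "simple_matroid M \<longleftrightarrow>
     matroid M \<and> (\<forall>x. \<not> loop M x) \<and> (\<forall>x y. \<not> parallel_pair M x y)"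

definition cocircuit :: "'a set_system \<Rightarrow> 'a set \<Rightarrow> bool" where
  "cocircuit M C \<longleftrightarrow> circuit (dual M) C"

definition coloop :: "'a set_system \<Rightarrow> 'a \<Rightarrow> bool" where
  "coloop M x \<longleftrightarrow> loop (dual M) x"

text \<open>The difference is taken in the integers, since \<open>k\<close> may exceed the rank.\<close>

definition loose :: "nat \<Rightarrow> 'a set_system \<Rightarrow> 'a \<Rightarrow> bool" where
  "loose k M t \<longleftrightarrow> t \<in> ground M \<and>
     (\<forall>C. circuit M C \<longrightarrow> t \<in> C \<longrightarrow> int (card C) > int (rank M) - int k)"

text \<open>
  A representation labels the elements of \<open>M\<close> by vectors of a vector space over \<open>F\<close>.
  Independence is that of the labelled family, hence the injectivity condition.
  Fixing the type of vectors to \<open>nat \<Rightarrow> 'f\<close> loses nothing: the labels span a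
  finite-dimensional space, which is isomorphic to some space of \<open>n\<close>-tuples over \<open>F\<close>.
\<close>

definition representable_over :: "('f, 'm) ring_scheme \<Rightarrow> 'a set_system \<Rightarrow> bool" where
  "representable_over F M \<longleftrightarrow>
     (\<exists>(V :: ('f, nat \<Rightarrow> 'f) module) \<phi>.
        vectorspace F V \<and>
        \<phi> \<in> ground M \<rightarrow> carrier V \<and>
        (\<forall>X \<subseteq> ground M. indep M X \<longleftrightarrow>
           inj_on \<phi> X \<and> \<not> module.lin_dep F V (\<phi> ` X)))"

end

theory Submission
  imports Defs
begin

text \<open>
  Suppose that \<open>{e, f}\<close> is not a cocircuit. As there are no coloops, it is coindependent, so some
  basis \<open>B\<close> avoids \<open>e\<close> and \<open>f\<close>. The linear relations on \<open>W = B \<union> {e, f}\<close> contain a pencil of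
  \<open>q + 1\<close> nontrivial relations, no two of them proportional, and each element of \<open>W\<close> has
  coefficient zero in at least one of them. On the other hand the support of a nontrivial relation
  contains a circuit, which meets \<open>{e, f}\<close> because \<open>B\<close> is independent; by looseness at most
  \<open>k + 1\<close> of the \<open>r + 2\<close> elements of \<open>W\<close> are outside the support.
  Thus \<open>r + 2 \<le> (q + 1) (k + 1)\<close>, which is the claimed bound.
\<close>

subsection \<open>Matroids\<close>

lemma finite_subset_ground:
  assumes "matroid M" "X \<subseteq> ground M"
  shows "finite X"
  using assms by (auto simp: matroid_def intro: finite_subset)

lemma indep_subset_ground:
  assumes "matroid M" "indep M X"
  shows "X \<subseteq> ground M"
  using assms by (simp add: matroid_def)

lemma indep_subset:
  assumes "matroid M" "indep M X" "Y \<subseteq> X"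
  shows "indep M Y"
  using assms unfolding matroid_def by blast

lemma indep_augment:
  assumes "matroid M" "indep M X" "indep M Y" "card X < card Y"
  obtains y where "y \<in> Y - X" "indep M (insert y X)"
  using assms unfolding matroid_def by metis

lemma indep_card_le_basis_card:
  assumes "matroid M" "basis M B" "indep M X"
  shows "card X \<le> card B"
proof (rule ccontr)
  assume "\<not> card X \<le> card B"
  then have "card B < card X"
    by simp
  moreover have "indep M B"
    using assms(2) by (simp add: basis_def)
  ultimately obtain y where "y \<in> X - B" "indep M (insert y B)"
    using indep_augment[OF assms(1) _ assms(3)] by blast
  then show False
    using assms(2) unfolding basis_def by blast
qed

lemma basis_card_eq_rank:
  assumes "matroid M" "basis M B"
  shows "card B = rank M"
proof -
  have card_le: "card X \<le> card B" if "indep M X" for X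
    using indep_card_le_basis_card[OF assms that] .
  have "rank M = card B"
    unfolding rank_def
  proof (rule Max_eqI)
    show "finite {card X |X. indep M X}"
      by (rule finite_subset[of _ "{..card B}"]) (use card_le in auto)
  qed (use card_le assms(2) in \<open>auto simp: basis_def\<close>)
  then show ?thesis by simp
qed

lemma basis_exists:
  assumes "matroid M"
  obtains B where "basis M B"
proof -
  have "{X. indep M X} \<subseteq> Pow (ground M)"
    using indep_subset_ground[OF assms] by blast
  then have "finite {X. indep M X}"
    using assms by (auto simp: matroid_def intro: finite_subset)
  moreover have "{} \<in> {X. indep M X}"
    using assms by (simp add: matroid_def)
  ultimately obtain B where "indep M B" "\<forall>X. indep M X \<longrightarrow> B \<subseteq> X \<longrightarrow> B = X"
    using finite_has_maximal[of "{X. indep M X}"] by blast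
  then have "basis M B"
    unfolding basis_def by blast
  then show thesis
    by (rule that)
qed

lemma dependent_contains_circuit:
  assumes "matroid M" "S \<subseteq> ground M" "\<not> indep M S"
  obtains C where "C \<subseteq> S" "circuit M C"
proof -
  let ?D = "{X \<in> Pow S. \<not> indep M X}"
  have "finite ?D" "S \<in> ?D"
    using finite_subset_ground[OF assms(1,2)] assms(3) by auto
  then obtain C where C: "C \<in> ?D" and minimal: "\<forall>X\<in>?D. X \<subseteq> C \<longrightarrow> C = X"
    using finite_has_minimal[of ?D] by auto
  have "indep M X" if "X \<subset> C" for X
    using that C minimal by auto
  then have "C \<subseteq> S" "circuit M C"
    using C assms(2) by (auto simp: circuit_def)
  then show thesis
    by (rule that)
qed

lemma indep_pair_if_not_circuit:
  assumes "indep M {}" "x \<in> ground M" "y \<in> ground M"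
    and "\<not> loop M x" "\<not> loop M y" "\<not> circuit M {x, y}"
  shows "indep M {x, y}"
proof -
  have "indep M {x}" "indep M {y}"
    using assms(1-5) by (auto simp: loop_def circuit_def psubset_eq subset_singleton_iff)
  then have "indep M X" if "X \<subset> {x, y}" for X
    using that assms(1) by (cases "X = {}"; cases "X = {x}"; cases "X = {y}") auto
  then show ?thesis
    using assms(2,3,6) unfolding circuit_def by blast
qed

lemma coindependent_pair_if_not_cocircuit:
  assumes "matroid M" "x \<in> ground M" "y \<in> ground M"
    and "\<not> coloop M x" "\<not> coloop M y" "\<not> cocircuit M {x, y}"
  shows "indep (dual M) {x, y}"
proof (rule indep_pair_if_not_circuit)
  show "indep (dual M) {}"
    using basis_exists[OF assms(1)] by (auto simp: dual_def)
qed (use assms in \<open>auto simp: dual_def coloop_def cocircuit_def\<close>)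

lemma card_dependent_gt_if_loose:
  assumes "matroid M" "indep M B" "\<forall>t\<in>T. loose k M t"
    and "S \<subseteq> B \<union> T" "\<not> indep M S"
  shows "int (card S) > int (rank M) - int k"
proof -
  have S: "S \<subseteq> ground M"
    using assms(3,4) indep_subset_ground[OF assms(1,2)] by (auto simp: loose_def)
  obtain C where C: "C \<subseteq> S" "circuit M C"
    using dependent_contains_circuit[OF assms(1) S assms(5)] .
  have "\<not> C \<subseteq> B"
    using C(2) indep_subset[OF assms(1,2)] by (auto simp: circuit_def)
  then obtain t where "t \<in> C" "t \<in> T"
    using C(1) assms(4) by blast
  then have "int (card C) > int (rank M) - int k"
    using assms(3) C(2) by (auto simp: loose_def)
  moreover have "card C \<le> card S"
    using C(1) finite_subset_ground[OF assms(1) S] by (intro card_mono)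
  ultimately show ?thesis by linarith
qed

subsection \<open>Linear relations between the members of a family\<close>

context module
begin

definition linear_relation :: "('i \<Rightarrow> 'c) \<Rightarrow> 'i set \<Rightarrow> ('i \<Rightarrow> 'a) \<Rightarrow> bool" where
  "linear_relation \<phi> W c \<longleftrightarrow>
     c \<in> W \<rightarrow> carrier R \<and> (\<Oplus>\<^bsub>M\<^esub>x\<in>W. c x \<odot>\<^bsub>M\<^esub> \<phi> x) = \<zero>\<^bsub>M\<^esub>"

lemma linear_relation_add_smult:
  assumes "finite W" "\<phi> \<in> W \<rightarrow> carrier M"
    and "linear_relation \<phi> W c" "linear_relation \<phi> W d" "t \<in> carrier R"
  shows "linear_relation \<phi> W (\<lambda>x. c x \<oplus> t \<otimes> d x)"
proof -
  have coeffs: "c x \<in> carrier R" "d x \<in> carrier R" "\<phi> x \<in> carrier M" if "x \<in> W" for x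
    using assms(2-4) that by (auto simp: linear_relation_def)
  have "(\<Oplus>\<^bsub>M\<^esub>x\<in>W. (c x \<oplus> t \<otimes> d x) \<odot>\<^bsub>M\<^esub> \<phi> x)
      = (\<Oplus>\<^bsub>M\<^esub>x\<in>W. c x \<odot>\<^bsub>M\<^esub> \<phi> x \<oplus>\<^bsub>M\<^esub> t \<odot>\<^bsub>M\<^esub> (d x \<odot>\<^bsub>M\<^esub> \<phi> x))"
    using coeffs assms(5) by (intro M.finsum_cong') (auto simp: smult_l_distr smult_assoc1)
  also have "\<dots> = (\<Oplus>\<^bsub>M\<^esub>x\<in>W. c x \<odot>\<^bsub>M\<^esub> \<phi> x) \<oplus>\<^bsub>M\<^esub> t \<odot>\<^bsub>M\<^esub> (\<Oplus>\<^bsub>M\<^esub>x\<in>W. d x \<odot>\<^bsub>M\<^esub> \<phi> x)"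
    using coeffs assms(1,5) by (subst M.finsum_addf) (auto simp: finsum_smult)
  also have "\<dots> = \<zero>\<^bsub>M\<^esub>"
    using assms(3-5) by (simp add: linear_relation_def)
  finally show ?thesis
    using coeffs assms(5) by (auto simp: linear_relation_def)
qed

lemma linear_relation_mono_neutral_cong:
  assumes "finite W" "S \<subseteq> W" "\<phi> \<in> W \<rightarrow> carrier M"
    and zero: "\<And>x. x \<in> W - S \<Longrightarrow> c x = \<zero>" and eq: "\<And>x. x \<in> S \<Longrightarrow> c x = d x"
  shows "linear_relation \<phi> W c \<longleftrightarrow> linear_relation \<phi> S d"
proof -
  have "c x \<in> carrier R" if "d \<in> S \<rightarrow> carrier R" "x \<in> W" for x
    using that zero[of x] eq[of x] by (cases "x \<in> S") auto
  moreover have "d x \<in> carrier R" if "c \<in> W \<rightarrow> carrier R" "x \<in> S" for x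
    using Pi_mem[OF that(1), of x] that(2) assms(2) eq[of x] by (simp add: subset_iff)
  ultimately have coeffs: "c \<in> W \<rightarrow> carrier R \<longleftrightarrow> d \<in> S \<rightarrow> carrier R"
    by blast
  have "(\<Oplus>\<^bsub>M\<^esub>x\<in>W. c x \<odot>\<^bsub>M\<^esub> \<phi> x) = (\<Oplus>\<^bsub>M\<^esub>x\<in>S. d x \<odot>\<^bsub>M\<^esub> \<phi> x)"
    if "c \<in> W \<rightarrow> carrier R"
    using assms that
    by (intro M.add.finprod_mono_neutral_cong_right) (auto simp: Pi_iff subset_iff)
  then show ?thesis
    using coeffs by (auto simp: linear_relation_def)
qed

lemma linear_relation_comp_iff_lincomb:
  assumes "inj_on \<phi> W" "\<phi> \<in> W \<rightarrow> carrier M"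
  shows "linear_relation \<phi> W (a \<circ> \<phi>) \<longleftrightarrow>
    a \<in> \<phi> ` W \<rightarrow> carrier R \<and> lincomb a (\<phi> ` W) = \<zero>\<^bsub>M\<^esub>"
proof -
  have "a \<circ> \<phi> \<in> W \<rightarrow> carrier R \<longleftrightarrow> a \<in> \<phi> ` W \<rightarrow> carrier R"
    by (auto simp: Pi_iff)
  moreover have "lincomb a (\<phi> ` W) = (\<Oplus>\<^bsub>M\<^esub>x\<in>W. (a \<circ> \<phi>) x \<odot>\<^bsub>M\<^esub> \<phi> x)"
    if "a \<in> \<phi> ` W \<rightarrow> carrier R"
    unfolding lincomb_def using assms that by (subst M.finsum_reindex) auto
  ultimately show ?thesis
    by (auto simp: linear_relation_def)
qed

lemma lin_dep_image_iff_nontrivial_relation: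
  assumes "finite W" "inj_on \<phi> W" "\<phi> \<in> W \<rightarrow> carrier M"
  shows "lin_dep (\<phi> ` W) \<longleftrightarrow> (\<exists>c. linear_relation \<phi> W c \<and> (\<exists>x\<in>W. c x \<noteq> \<zero>))"
proof
  assume dep: "lin_dep (\<phi> ` W)"
  have "finite (\<phi> ` W)" "\<phi> ` W \<subseteq> carrier M"
    using assms(1,3) by auto
  then obtain a x where "a \<in> \<phi> ` W \<rightarrow> carrier R" "lincomb a (\<phi> ` W) = \<zero>\<^bsub>M\<^esub>"
    and x: "x \<in> W" "a (\<phi> x) \<noteq> \<zero>"
    using finite_lin_dep[OF _ dep] by (auto simp: image_iff)
  then have "linear_relation \<phi> W (a \<circ> \<phi>)"
    using linear_relation_comp_iff_lincomb[OF assms(2,3)] by simp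
  then show "\<exists>c. linear_relation \<phi> W c \<and> (\<exists>x\<in>W. c x \<noteq> \<zero>)"
    using x by (intro exI[of _ "a \<circ> \<phi>"]) auto
next
  assume "\<exists>c. linear_relation \<phi> W c \<and> (\<exists>x\<in>W. c x \<noteq> \<zero>)"
  then obtain c x where c: "linear_relation \<phi> W c" and x: "x \<in> W" "c x \<noteq> \<zero>"
    by blast
  define a where "a = c \<circ> inv_into W \<phi>"
  have a: "(a \<circ> \<phi>) y = c y" if "y \<in> W" for y
    using that assms(2) by (simp add: a_def)
  have "linear_relation \<phi> W (a \<circ> \<phi>) \<longleftrightarrow> linear_relation \<phi> W c"
    using assms(1,3) a by (intro linear_relation_mono_neutral_cong) auto
  with c have "linear_relation \<phi> W (a \<circ> \<phi>)"
    by simp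
  then have "a \<in> \<phi> ` W \<rightarrow> carrier R" "lincomb a (\<phi> ` W) = \<zero>\<^bsub>M\<^esub>"
    using linear_relation_comp_iff_lincomb[OF assms(2,3)] by auto
  then show "lin_dep (\<phi> ` W)"
    using x a[OF x(1)] assms(1) by (intro lin_dep_crit[of "\<phi> ` W" _ a "\<phi> x"]) auto
qed

lemma nontrivial_relation_if_not_inj:
  assumes "finite W" "\<phi> \<in> W \<rightarrow> carrier M" "\<not> inj_on \<phi> W" "\<one> \<noteq> \<zero>"
  obtains c x where "linear_relation \<phi> W c" "x \<in> W" "c x \<noteq> \<zero>"
proof -
  obtain x y where xy: "x \<in> W" "y \<in> W" "x \<noteq> y" "\<phi> x = \<phi> y"
    using assms(3) by (auto simp: inj_on_def)
  define c where "c z = (if z = x then \<one> else if z = y then \<ominus> \<one> else \<zero>)" for z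
  have "\<phi> y \<in> carrier M"
    using assms(2) xy(2) by auto
  then have "linear_relation \<phi> {x, y} c"
    using xy(3,4) by (simp add: linear_relation_def c_def smult_l_minus M.r_neg)
  moreover have "linear_relation \<phi> W c \<longleftrightarrow> linear_relation \<phi> {x, y} c"
    using xy assms(1,2) by (intro linear_relation_mono_neutral_cong) (auto simp: c_def)
  moreover have "c x \<noteq> \<zero>"
    using assms(4) by (simp add: c_def)
  ultimately show thesis
    using xy(1) that by blast
qed

end

subsection \<open>Zeros of the members of a pencil\<close>

lemma (in field) ex_add_mult_eq_zero:
  assumes "a \<in> carrier R" "b \<in> carrier R" "b \<noteq> \<zero>"
  obtains t where "t \<in> carrier R" "a \<oplus> t \<otimes> b = \<zero>"
proof
  have b: "inv b \<in> carrier R" "inv b \<otimes> b = \<one>"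
    using assms(2,3) field_Units by auto
  then show "\<ominus> (a \<otimes> inv b) \<in> carrier R"
    using assms(1) by simp
  show "a \<oplus> \<ominus> (a \<otimes> inv b) \<otimes> b = \<zero>"
    using assms(1,2) b by (simp add: l_minus m_assoc r_neg)
qed

lemma (in field) card_le_pencil_zeros:
  assumes "finite (carrier R)" "finite W" "c \<in> W \<rightarrow> carrier R" "d \<in> W \<rightarrow> carrier R"
    and zeros_d: "card {x \<in> W. d x = \<zero>} \<le> m"
    and zeros_pencil: "\<And>t. t \<in> carrier R \<Longrightarrow> card {x \<in> W. c x \<oplus> t \<otimes> d x = \<zero>} \<le> m"
  shows "card W \<le> (card (carrier R) + 1) * m"
proof -
  let ?Z = "\<lambda>t. {x \<in> W. c x \<oplus> t \<otimes> d x = \<zero>}"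
  have "x \<in> {x \<in> W. d x = \<zero>} \<union> (\<Union>t\<in>carrier R. ?Z t)" if "x \<in> W" for x
  proof (cases "d x = \<zero>")
    case False
    have "c x \<in> carrier R" "d x \<in> carrier R"
      using assms(3,4) that by auto
    then obtain t where "t \<in> carrier R" "c x \<oplus> t \<otimes> d x = \<zero>"
      using False by (rule ex_add_mult_eq_zero)
    then show ?thesis
      using that by blast
  qed (use that in simp)
  then have "card W \<le> card ({x \<in> W. d x = \<zero>} \<union> (\<Union>t\<in>carrier R. ?Z t))"
    using assms(1,2) by (intro card_mono) auto
  also have "\<dots> \<le> card {x \<in> W. d x = \<zero>} + card (\<Union>t\<in>carrier R. ?Z t)"
    by (rule card_Un_le)
  also have "\<dots> \<le> m + (\<Sum>t\<in>carrier R. card (?Z t))"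
    using zeros_d card_UN_le[OF assms(1), of ?Z] by (rule add_mono)
  also have "(\<Sum>t\<in>carrier R. card (?Z t)) \<le> card (carrier R) * m"
    using sum_bounded_above[of "carrier R" "\<lambda>t. card (?Z t)" m] zeros_pencil by simp
  finally show ?thesis by simp
qed

lemma (in vectorspace) card_le_if_relations_have_few_zeros:
  assumes "finite (carrier K)" "finite W" "\<phi> \<in> W \<rightarrow> carrier V"
    and few_zeros: "\<And>c x. linear_relation \<phi> W c \<Longrightarrow> x \<in> W \<Longrightarrow> c x \<noteq> \<zero>\<^bsub>K\<^esub> \<Longrightarrow>
      card {y \<in> W. c y = \<zero>\<^bsub>K\<^esub>} \<le> m"
    and c: "linear_relation \<phi> W c" "e \<in> W" "c e \<noteq> \<zero>\<^bsub>K\<^esub>"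
    and d: "linear_relation \<phi> W d" "f \<in> W" "d f \<noteq> \<zero>\<^bsub>K\<^esub>" "d e = \<zero>\<^bsub>K\<^esub>"
  shows "card W \<le> (card (carrier K) + 1) * m"
proof -
  have coeffs: "c \<in> W \<rightarrow> carrier K" "d \<in> W \<rightarrow> carrier K"
    using c(1) d(1) by (simp_all add: linear_relation_def)
  have "card {x \<in> W. c x \<oplus>\<^bsub>K\<^esub> t \<otimes>\<^bsub>K\<^esub> d x = \<zero>\<^bsub>K\<^esub>} \<le> m" if t: "t \<in> carrier K" for t
  proof (rule few_zeros)
    show "linear_relation \<phi> W (\<lambda>x. c x \<oplus>\<^bsub>K\<^esub> t \<otimes>\<^bsub>K\<^esub> d x)"
      using assms(2,3) c(1) d(1) t by (rule linear_relation_add_smult)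
    show "c e \<oplus>\<^bsub>K\<^esub> t \<otimes>\<^bsub>K\<^esub> d e \<noteq> \<zero>\<^bsub>K\<^esub>"
      using Pi_mem[OF coeffs(1) c(2)] c(3) d(4) t by simp
  qed (rule c(2))
  with few_zeros[OF d(1-3)] show ?thesis
    by (rule card_le_pencil_zeros[OF assms(1,2) coeffs])
qed

subsection \<open>Represented matroids\<close>

locale represented_matroid = vectorspace K V
  for K :: "('f, 'm) ring_scheme" and V :: "('f, 'v, 'n) module_scheme" +
  fixes M :: "'a set_system" and \<phi> :: "'a \<Rightarrow> 'v"
  assumes matroid: "matroid M"
    and labels: "\<phi> \<in> ground M \<rightarrow> carrier V"
    and indep_iff: "X \<subseteq> ground M \<Longrightarrow> indep M X \<longleftrightarrow> inj_on \<phi> X \<and> lin_indpt (\<phi> ` X)"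
begin

lemma labels_subset:
  assumes "X \<subseteq> ground M"
  shows "\<phi> \<in> X \<rightarrow> carrier V"
  using labels assms by auto

lemma dependent_iff_nontrivial_relation:
  assumes "X \<subseteq> ground M"
  shows "\<not> indep M X \<longleftrightarrow> (\<exists>c. linear_relation \<phi> X c \<and> (\<exists>x\<in>X. c x \<noteq> \<zero>\<^bsub>K\<^esub>))"
proof (cases "inj_on \<phi> X")
  case True
  then show ?thesis
    using lin_dep_image_iff_nontrivial_relation[OF finite_subset_ground[OF matroid assms] True
        labels_subset[OF assms]] indep_iff[OF assms] by simp
next
  case False
  obtain c x where "linear_relation \<phi> X c" "x \<in> X" "c x \<noteq> \<zero>\<^bsub>K\<^esub>"
    using finite_subset_ground[OF matroid assms] labels_subset[OF assms] False one_not_zero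
    by (rule nontrivial_relation_if_not_inj)
  then show ?thesis
    using indep_iff[OF assms] False by auto
qed

lemma support_of_nontrivial_relation_dependent:
  assumes "W \<subseteq> ground M" "linear_relation \<phi> W c" "x \<in> W" "c x \<noteq> \<zero>\<^bsub>K\<^esub>"
  shows "\<not> indep M {y \<in> W. c y \<noteq> \<zero>\<^bsub>K\<^esub>}"
proof -
  let ?S = "{y \<in> W. c y \<noteq> \<zero>\<^bsub>K\<^esub>}"
  have "linear_relation \<phi> W c \<longleftrightarrow> linear_relation \<phi> ?S c"
    using finite_subset_ground[OF matroid assms(1)] labels_subset[OF assms(1)]
    by (intro linear_relation_mono_neutral_cong) auto
  moreover have "x \<in> ?S" "?S \<subseteq> ground M"
    using assms(1,3,4) by auto
  ultimately show ?thesis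
    using dependent_iff_nontrivial_relation[of ?S] assms(2,4) by auto
qed

lemma relation_involving_spanned_element:
  assumes "indep M B" "\<not> indep M (insert x B)" "insert x B \<subseteq> W" "W \<subseteq> ground M"
  obtains c where "linear_relation \<phi> W c" "c x \<noteq> \<zero>\<^bsub>K\<^esub>" "\<forall>y. y \<notin> insert x B \<longrightarrow> c y = \<zero>\<^bsub>K\<^esub>"
proof -
  have ground: "insert x B \<subseteq> ground M"
    using assms(3,4) by (rule subset_trans)
  obtain c y where c: "linear_relation \<phi> (insert x B) c" "y \<in> insert x B" "c y \<noteq> \<zero>\<^bsub>K\<^esub>"
    using dependent_iff_nontrivial_relation[OF ground] assms(2) by auto
  have nonzero: "c x \<noteq> \<zero>\<^bsub>K\<^esub>"
  proof
    assume "c x = \<zero>\<^bsub>K\<^esub>"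
    then have "{z \<in> insert x B. c z \<noteq> \<zero>\<^bsub>K\<^esub>} \<subseteq> B"
      by auto
    then show False
      using support_of_nontrivial_relation_dependent[OF ground c] indep_subset[OF matroid assms(1)]
      by simp
  qed
  define c' where "c' z = (if z \<in> insert x B then c z else \<zero>\<^bsub>K\<^esub>)" for z
  have "linear_relation \<phi> W c' \<longleftrightarrow> linear_relation \<phi> (insert x B) c"
    using assms(3) finite_subset_ground[OF matroid assms(4)] labels_subset[OF assms(4)]
    by (intro linear_relation_mono_neutral_cong) (auto simp: c'_def)
  then show thesis
    using that[of c'] c(1) nonzero by (simp add: c'_def)
qed

lemma card_relation_zeros_less:
  assumes "indep M B" "\<forall>t\<in>T. loose k M t"
    and "linear_relation \<phi> (B \<union> T) c" "x \<in> B \<union> T" "c x \<noteq> \<zero>\<^bsub>K\<^esub>"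
  shows "int (card {y \<in> B \<union> T. c y = \<zero>\<^bsub>K\<^esub>}) < int (card (B \<union> T)) - int (rank M) + int k"
proof -
  let ?S = "{y \<in> B \<union> T. c y \<noteq> \<zero>\<^bsub>K\<^esub>}"
  have W: "B \<union> T \<subseteq> ground M"
    using indep_subset_ground[OF matroid assms(1)] assms(2) by (auto simp: loose_def)
  have "int (card ?S) > int (rank M) - int k"
    using card_dependent_gt_if_loose[OF matroid assms(1,2) _
        support_of_nontrivial_relation_dependent[OF W assms(3-5)]] by auto
  moreover have "card (B \<union> T) = card {y \<in> B \<union> T. c y = \<zero>\<^bsub>K\<^esub>} + card ?S"
    using finite_subset_ground[OF matroid W]
    by (subst card_Un_disjoint[symmetric]) (auto intro: arg_cong[where f = card])
  ultimately show ?thesis by linarith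
qed

theorem rank_bound_if_coindependent_loose_pair:
  assumes "finite (carrier K)" "e \<noteq> f" "indep (dual M) {e, f}" "loose k M e" "loose k M f"
  shows "rank M + 2 \<le> (card (carrier K) + 1) * (k + 1)"
proof -
  obtain B where basis: "Defs.basis M B" and ef: "e \<notin> B" "f \<notin> B"
    using assms(3) by (auto simp: dual_def)
  have indep: "indep M B"
    using basis by (simp add: Defs.basis_def)
  have dep: "\<not> indep M (insert x B)" if "x \<notin> B" for x
    using basis that by (auto simp: Defs.basis_def)
  define W where "W = B \<union> {e, f}"
  have W: "W \<subseteq> ground M" "insert e B \<subseteq> W" "insert f B \<subseteq> W"
    using indep_subset_ground[OF matroid indep] assms(4,5) by (auto simp: loose_def W_def)
  have finite: "finite W"
    using finite_subset_ground[OF matroid W(1)] .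
  have card: "card W = rank M + 2"
    using basis_card_eq_rank[OF matroid basis] ef assms(2) finite by (simp add: W_def)
  have few_zeros: "card {y \<in> W. c y = \<zero>\<^bsub>K\<^esub>} \<le> k + 1"
    if "linear_relation \<phi> W c" "x \<in> W" "c x \<noteq> \<zero>\<^bsub>K\<^esub>" for c x
    using card_relation_zeros_less[OF indep, of "{e, f}" k c x] that assms(4,5) card
    by (simp add: W_def)
  obtain c where c: "linear_relation \<phi> W c" "c e \<noteq> \<zero>\<^bsub>K\<^esub>"
    using relation_involving_spanned_element[OF indep dep[OF ef(1)] W(2,1)] .
  obtain d where d: "linear_relation \<phi> W d" "d f \<noteq> \<zero>\<^bsub>K\<^esub>"
    and zero: "\<forall>x. x \<notin> insert f B \<longrightarrow> d x = \<zero>\<^bsub>K\<^esub>"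
    using relation_involving_spanned_element[OF indep dep[OF ef(2)] W(3,1)] .
  have "d e = \<zero>\<^bsub>K\<^esub>"
    using zero ef(1) assms(2) by simp
  then have "card W \<le> (card (carrier K) + 1) * (k + 1)"
    using card_le_if_relations_have_few_zeros[OF assms(1) finite labels_subset[OF W(1)] few_zeros
        c(1) _ c(2) d(1) _ d(2)] W(2,3) by simp
  then show ?thesis
    by (simp add: card)
qed

end

theorem theorem1p2:
  fixes q k :: nat
    and F :: "('f, 'm) ring_scheme"
    and M :: "'a set_system"
    and e f :: 'a
  assumes "primepow q"
    and "field F" and "card (carrier F) = q"
    and "representable_over F M"
    and "simple_matroid M"
    and "\<forall>x \<in> ground M. \<not> coloop M x"
    and "e \<noteq> f" and "loose k M e" and "loose k M f"
  shows "int (rank M) \<le> (int q + 1) * (int k - 1) + 2 * int q \<or> cocircuit M {e, f}"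
proof (rule disjCI)
  assume not_cocircuit: "\<not> cocircuit M {e, f}"
  have matroid: "matroid M"
    using assms(5) by (simp add: simple_matroid_def)
  obtain V :: "('f, nat \<Rightarrow> 'f) module" and \<phi> where "vectorspace F V"
    and "\<phi> \<in> ground M \<rightarrow> carrier V"
    and "\<forall>X\<subseteq>ground M. indep M X \<longleftrightarrow> inj_on \<phi> X \<and> \<not> module.lin_dep F V (\<phi> ` X)"
    using assms(4) unfolding representable_over_def by blast
  then interpret represented_matroid F V M \<phi>
    using matroid by (simp add: represented_matroid_def represented_matroid_axioms_def)
  have "e \<in> ground M" "f \<in> ground M"
    using assms(8,9) by (simp_all add: loose_def)
  then have "indep (dual M) {e, f}"
    using coindependent_pair_if_not_cocircuit[OF matroid] assms(6) not_cocircuit by blast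
  moreover have "finite (carrier F)"
    using assms(1,3) by (auto intro: card_ge_0_finite simp: primepow_gt_0_nat)
  ultimately have "rank M + 2 \<le> (q + 1) * (k + 1)"
    using rank_bound_if_coindependent_loose_pair assms(3,7-9) by blast
  then have "int (rank M + 2) \<le> int ((q + 1) * (k + 1))"
    by (rule zle_int[THEN iffD2])
  then show "int (rank M) \<le> (int q + 1) * (int k - 1) + 2 * int q"
    by (simp add: algebra_simps)
qed

end
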